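(* Let $\{x(k)\}_{k\in\mathbb{N}}$ be a sequence of points generated by the asynchronous algorithm with the gradient-step update and uniform node activation probabilities (defined in the context). Then, with probability one, there exists a minimizer of $\hat f$, denoted by $x^\star\in\mathcal{X}^\star$ (possibly depending on the realization), such that $$x(k)\to x^\star\quad\text{as }k\to\infty.$$
   Context: Network. Let $\mathcal{G}=(\mathcal{V},\mathcal{E})$ be a finite undirected simple graph with $\mathcal{V}=\{1,\dots,n\}$ (sensors); write $i\sim j$ for an edge. Let $p\in\{2,3\}$, let $\mathcal{A}=\{1,\dots,m\}$ be a set of anchors with known positions $a_k\in\mathbb{R}^p$, and for each $i\in\mathcal{V}$ let $\mathcal{A}_i\subset\mathcal{A}$ be the (possibly empty) set of anchors linked to sensor $i$. For each edge $i\sim j$ a measurement $d_{ij}=d_{ji}\ge 0$ is given, and for each $i\in\mathcal{V}$, $k\in\mathcal{A}_i$ a measurement $r_{ik}\ge 0$ is given. Standing assumption: there is at least one anchor linked to some sensor (some $\mathcal{A}_i\neq\emptyset$), and $\mathcal{G}$ is connected. Cost function. For a nonempty set $C$, $\mathrm{d}_C^2(x)=\inf_{y\in C}\|x-y\|^2$ (Euclidean norm). Let $\mathrm{B}_{ij}=\{z\in\mathbb{R}^p:\|z\|\le d_{ij}\}$ and $\mathrm{Ba}_{ik}=\{z\in\mathbb{R}^p:\|z-a_k\|\le r_{ik}\}$. For $x=(x_1,\dots,x_n)\in(\mathbb{R}^p)^n$ define $$\hat f(x)=\sum_{i\sim j}\tfrac12\,\mathrm{d}^2_{\mathrm{B}_{ij}}(x_i-x_j)+\sum_{i\in\mathcal{V}}\sum_{k\in\mathcal{A}_i}\tfrac12\,\mathrm{d}^2_{\mathrm{Ba}_{ik}}(x_i),$$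 each edge being counted once. The function $\hat f$ is convex and differentiable; $\nabla_i\hat f$ denotes its gradient with respect to $x_i$. Put $\hat f^\star=\inf_x\hat f(x)$ and $\mathcal{X}^\star=\{x:\hat f(x)=\hat f^\star\}$. Let $L_{\hat f}=2\delta_{\max}+\max_{i\in\mathcal{V}}|\mathcal{A}_i|$, where $\delta_{\max}$ is the maximum node degree of $\mathcal{G}$. Asynchronous algorithm with gradient-step update. Let $\{\xi_k\}_{k\ge1}$ be independent random variables with values in $\mathcal{V}$ and $\mathbb{P}(\xi_k=i)=\frac1n$ for all $i\in\mathcal{V}$ and all $k$. The initial point $x(0)$ is arbitrary, possibly random, independent of $\{\xi_k\}$. At iteration $k\ge1$, if $\xi_k=i$, then $x_j(k)=x_j(k-1)$ for all $j\ne i$, and $$x_i(k)=x_i(k-1)-\frac{1}{L_{\hat f}}\nabla_i\hat f(x(k-1)).$$ *)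

theory Defs
  imports "HOL-Probability.Probability"
begin

text \<open>
  Sensors are the elements of \<open>'n\<close>, anchors those of \<open>'m\<close>, and a configuration of sensor
  positions is \<open>x :: real ^ 'p ^ 'n\<close>, with \<open>x $ i\<close> the position of sensor \<open>i\<close>.
  An undirected simple graph is an irreflexive and symmetric relation \<open>E\<close>.  The order on \<open>'n\<close>
  plays the role of the order of the labels \<open>1, \<dots>, n\<close>; it only serves to count every edge once.
\<close>

definition sqdist :: "'a::real_normed_vector set \<Rightarrow> 'a \<Rightarrow> real" where
  "sqdist C x = (INF y\<in>C. (norm (x - y))\<^sup>2)"

definition fhat ::
  "('n::{finite,linorder} \<times> 'n::{finite,linorder}) set \<Rightarrow> ('n::{finite,linorder} \<Rightarrow> 'm::finite set) \<Rightarrow>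
   ('m::finite \<Rightarrow> real ^ 'p::finite) \<Rightarrow> ('n::{finite,linorder} \<Rightarrow> 'n::{finite,linorder} \<Rightarrow> real) \<Rightarrow>
   ('n::{finite,linorder} \<Rightarrow> 'm::finite \<Rightarrow> real) \<Rightarrow> real ^ 'p::finite ^ 'n::{finite,linorder} \<Rightarrow> real" where
  "fhat E A a d r x =
     (\<Sum>(i, j) \<in> {(i, j) \<in> E. i < j}. 1/2 * sqdist (cball 0 (d i j)) (x $ i - x $ j)) +
     (\<Sum>i\<in>UNIV. \<Sum>k\<in>A i. 1/2 * sqdist (cball (a k) (r i k)) (x $ i))"

text \<open>Intended for \<open>f\<close> bounded below, as \<open>fhat\<close> is by \<open>0\<close>; otherwise \<open>INF\<close> is unspecified.\<close>

definition minimizers :: "('a \<Rightarrow> real) \<Rightarrow> 'a set" where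
  "minimizers f = {x. f x = (INF y. f y)}"

definition degree_of :: "('n::finite \<times> 'n) set \<Rightarrow> 'n \<Rightarrow> nat" where
  "degree_of E i = card {j. (i, j) \<in> E}"

definition L_fhat :: "('n::finite \<times> 'n) set \<Rightarrow> ('n \<Rightarrow> 'm::finite set) \<Rightarrow> real" where
  "L_fhat E A = 2 * real (Max (range (degree_of E))) + real (Max (range (\<lambda>i. card (A i))))"

definition set_block :: "'a ^ 'n \<Rightarrow> 'n \<Rightarrow> 'a \<Rightarrow> 'a ^ 'n::finite" where
  "set_block x i z = (\<chi> j. if j = i then z else x $ j)"

text \<open>The gradient of \<open>f\<close> with respect to the block \<open>x $ i\<close>, meaningful wherever it exists.\<close>

definition block_gradient ::
  "('a::real_inner ^ 'n::finite \<Rightarrow> real) \<Rightarrow> 'n \<Rightarrow> 'a ^ 'n \<Rightarrow> 'a" where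
  "block_gradient f i x = (THE g. GDERIV (\<lambda>z. f (set_block x i z)) (x $ i) :> g)"

lemma block_gradient_eqI:
  assumes "GDERIV (\<lambda>z. f (set_block x i z)) (x $ i) :> g"
  shows "block_gradient f i x = g"
  unfolding block_gradient_def
proof (rule the_equality[where P = "\<lambda>g. GDERIV (\<lambda>z. f (set_block x i z)) (x $ i) :> g", OF assms])
  fix h assume "GDERIV (\<lambda>z. f (set_block x i z)) (x $ i) :> h"
  with assms have "(\<lambda>z. inner z h) = (\<lambda>z. inner z g)"
    unfolding gderiv_def by (metis has_derivative_unique)
  then have "inner z h = inner z g" for z
    by metis
  then have "inner (h - g) (h - g) = 0"
    by (simp add: inner_diff_right)
  then show "h = g"
    by simp
qed

definition gradient_step ::
  "real \<Rightarrow> ('a::real_inner ^ 'n::finite \<Rightarrow> real) \<Rightarrow> 'n \<Rightarrow> 'a ^ 'n \<Rightarrow> 'a ^ 'n" where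
  "gradient_step L f i x = set_block x i (x $ i - (1 / L) *\<^sub>R block_gradient f i x)"

text \<open>
  The library's \<open>indep_var\<close> requires both random variables to have values in the same type.
\<close>

definition indep_rvs ::
  "'w measure \<Rightarrow> 'a measure \<Rightarrow> ('w \<Rightarrow> 'a) \<Rightarrow> 'b measure \<Rightarrow> ('w \<Rightarrow> 'b) \<Rightarrow> bool" where
  "indep_rvs M N X N' Y \<longleftrightarrow>
     X \<in> measurable M N \<and> Y \<in> measurable M N' \<and>
     prob_space.indep_set M {X -` S \<inter> space M |S. S \<in> sets N} {Y -` S \<inter> space M |S. S \<in> sets N'}"

end

theory Submission
  imports Defs "HOL-Real_Asymp.Real_Asymp"
begin

text \<open>
  Every residual map \<open>z \<mapsto> z - P\<^sub>C z\<close> is firmly nonexpansive, so \<open>\<nabla>f\<close> is co-coercive with constant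
  \<open>1/L\<close>; hence a uniformly random block step decreases the expected squared distance to any minimizer
  \<open>y\<close> by at least a multiple of \<open>\<parallel>\<nabla>f x\<parallel>\<^sup>2\<close>.  Summing up, \<open>\<nabla>f\<close> tends to \<open>0\<close> almost surely along the
  trajectory, and by Ville's inequality the trajectory is almost surely bounded, so that its distance
  to the set of minimizers tends to \<open>0\<close>.  Ville's inequality, restarted at time \<open>n\<close> with \<open>y\<close> the
  minimizer nearest to the current point, bounds the probability of an oscillation of size
  \<open>2\<epsilon>\<close> at infinity by the expectation of the squared distance over \<open>\<epsilon>\<^sup>2\<close>, truncated at \<open>1\<close>.  This tends
  to \<open>0\<close> with \<open>n\<close>, so the trajectory is almost surely Cauchy.
\<close>

subsection \<open>Stochastic Fejer monotonicity\<close>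

text \<open>All randomness sits in the stream, so the starting point can be varied freely in
  inductions over the first letter. Letter \<open>k\<close>, counted from 0, drives the step from
  time \<open>k\<close> to time \<open>k + 1\<close>.\<close>

primrec orbit :: "('i \<Rightarrow> 'a \<Rightarrow> 'a) \<Rightarrow> 'i stream \<Rightarrow> 'a \<Rightarrow> nat \<Rightarrow> 'a" where
  "orbit T \<omega> z 0 = z"
| "orbit T \<omega> z (Suc k) = T (\<omega> !! k) (orbit T \<omega> z k)"

text \<open>The Markov property in pathwise form: integrating over \<open>\<Omega>\<close> splits
  off the first letter, and the remaining stream, again distributed as \<open>\<Omega>\<close>,
  drives an orbit from \<open>T i z\<close>.\<close>

lemma orbit_SCons: "orbit T (i ## \<omega>) z (Suc k) = orbit T \<omega> (T i z) k"
  by (induction k) auto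

text \<open>\<open>descent\<close> says that the squared distance to each fixed zero of
  \<open>\<phi>\<close> is a supermartingale whose expected one-step decrease is at least
  \<open>\<phi> x\<close>. Integrals with values in \<open>ennreal\<close> spare integrability
  conditions.\<close>

locale stochastic_fejer =
  fixes p :: "'i::countable pmf" and T :: "'i \<Rightarrow> 'a::euclidean_space \<Rightarrow> 'a" and \<phi> :: "'a \<Rightarrow> real"
  assumes measurable_T: "T i \<in> borel_measurable borel"
    and continuous_gap: "continuous_on UNIV \<phi>"
    and gap_nonneg: "\<phi> x \<ge> 0"
    and zero_exists: "\<exists>y. \<phi> y = 0"
    and descent: "\<phi> y = 0 \<Longrightarrow>
      (\<integral>\<^sup>+i. ennreal ((dist (T i x) y)\<^sup>2) \<partial>measure_pmf p) + ennreal (\<phi> x) \<le> ennreal ((dist x y)\<^sup>2)"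
begin

abbreviation "\<Omega> \<equiv> stream_space (measure_pmf p)"

abbreviation "zeros \<equiv> {y. \<phi> y = 0}"

lemma closed_zeros: "closed zeros"
  using continuous_gap by (intro closed_Collect_eq) auto

lemma descent_dist:
  "\<phi> y = 0 \<Longrightarrow> (\<integral>\<^sup>+i. ennreal ((dist (T i x) y)\<^sup>2) \<partial>measure_pmf p) \<le> ennreal ((dist x y)\<^sup>2)"
  by (rule order_trans[OF _ descent]) simp_all

lemma measurable_gap [measurable]: "\<phi> \<in> borel_measurable borel"
  using continuous_gap by (rule borel_measurable_continuous_onI)

lemma space_paths [simp]: "space \<Omega> = UNIV"
  by (simp add: space_stream_space)

interpretation paths: prob_space \<Omega>
  by (rule prob_space.prob_space_stream_space[OF prob_space_measure_pmf])

lemma sets_Collect_paths: "Measurable.pred \<Omega> P \<Longrightarrow> {\<omega>. P \<omega>} \<in> sets \<Omega>"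
  by (simp add: pred_def)

text \<open>Joint measurability serves the random initial point. There are countably many letters,
  so the step can be handled separately on each event that fixes the letter.\<close>

lemma measurable_orbit_pair:
  "(\<lambda>(z, \<omega>). orbit T \<omega> z k) \<in> borel_measurable (borel \<Otimes>\<^sub>M \<Omega>)"
proof (induction k)
  case (Suc k)
  note Suc[measurable] measurable_T[measurable]
  have "(\<lambda>w. T (snd w !! k) ((\<lambda>(z, \<omega>). orbit T \<omega> z k) w)) \<in> borel_measurable (borel \<Otimes>\<^sub>M \<Omega>)"
    by (rule measurable_compose_countable[where g = "\<lambda>w. snd w !! k"]) measurable
  then show ?case by (simp add: case_prod_unfold)
qed (simp add: case_prod_unfold)

lemma measurable_orbit [measurable]: "(\<lambda>\<omega>. orbit T \<omega> z k) \<in> borel_measurable \<Omega>"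
  using measurable_compose[OF measurable_Pair1' measurable_orbit_pair[of k], of z] by simp

section \<open>Vanishing of the gap and boundedness along almost every path\<close>

lemma emeasure_paths [simp]: "emeasure \<Omega> UNIV = 1"
  using paths.emeasure_space_1 by simp

text \<open>\<open>descent\<close> telescopes: after the first letter, the induction hypothesis at
  \<open>T i z\<close> bounds the later gaps by the expected squared distance after one step, and
  \<open>descent\<close> pays for the additional \<open>\<phi> z\<close>.\<close>

lemma sum_gap_le:
  assumes "\<phi> y = 0"
  shows "(\<integral>\<^sup>+\<omega>. (\<Sum>k<N. ennreal (\<phi> (orbit T \<omega> z k))) \<partial>\<Omega>) \<le> ennreal ((dist z y)\<^sup>2)"
proof (induction N arbitrary: z)
  case (Suc N)
  have "(\<integral>\<^sup>+\<omega>. (\<Sum>k<Suc N. ennreal (\<phi> (orbit T \<omega> z k))) \<partial>\<Omega>)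
      = (\<integral>\<^sup>+i. \<integral>\<^sup>+\<omega>. ennreal (\<phi> z) + (\<Sum>k<N. ennreal (\<phi> (orbit T \<omega> (T i z) k))) \<partial>\<Omega> \<partial>measure_pmf p)"
    by (subst prob_space.nn_integral_stream_space[OF prob_space_measure_pmf])
       (simp_all add: sum.lessThan_Suc_shift orbit_SCons del: sum.lessThan_Suc orbit.simps(2))
  also have "\<dots> = ennreal (\<phi> z) +
      (\<integral>\<^sup>+i. \<integral>\<^sup>+\<omega>. (\<Sum>k<N. ennreal (\<phi> (orbit T \<omega> (T i z) k))) \<partial>\<Omega> \<partial>measure_pmf p)"
    using measure_pmf.emeasure_space_1[of p] by (simp add: nn_integral_add)
  also have "\<dots> \<le> ennreal (\<phi> z) + (\<integral>\<^sup>+i. ennreal ((dist (T i z) y)\<^sup>2) \<partial>measure_pmf p)"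
    by (intro add_left_mono nn_integral_mono Suc)
  also have "\<dots> \<le> ennreal ((dist z y)\<^sup>2)"
    using descent[OF assms, of z] by (simp add: add.commute)
  finally show ?case .
qed simp

text \<open>The bound on partial sums is uniform, so the whole series has finite expectation and
  almost surely converges.\<close>

lemma AE_gap_tendsto_0: "AE \<omega> in \<Omega>. (\<lambda>k. \<phi> (orbit T \<omega> z k)) \<longlonglongrightarrow> 0"
proof -
  obtain y where y: "\<phi> y = 0" using zero_exists by blast
  let ?f = "\<lambda>k \<omega>. ennreal (\<phi> (orbit T \<omega> z k))"
  have "(\<integral>\<^sup>+\<omega>. (\<Sum>k. ?f k \<omega>) \<partial>\<Omega>) = (\<Sum>k. \<integral>\<^sup>+\<omega>. ?f k \<omega> \<partial>\<Omega>)"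
    by (rule nn_integral_suminf) measurable
  also have "\<dots> \<le> ennreal ((dist z y)\<^sup>2)"
    using sum_gap_le[OF y] by (intro suminf_le_const) (simp_all add: nn_integral_sum)
  finally have "(\<integral>\<^sup>+\<omega>. (\<Sum>k. ?f k \<omega>) \<partial>\<Omega>) < \<infinity>"
    by (rule le_less_trans) simp
  then have "AE \<omega> in \<Omega>. (\<Sum>k. ?f k \<omega>) \<noteq> \<infinity>"
    by (intro nn_integral_PInf_AE) auto
  then show ?thesis
  proof eventually_elim
    case (elim \<omega>)
    then have "summable (\<lambda>k. \<phi> (orbit T \<omega> z k))"
      by (intro summable_suminf_not_top) (auto simp: gap_nonneg)
    then show ?case by (rule summable_LIMSEQ_zero)
  qed
qed

text \<open>Ville's maximal inequality, by first-step analysis.\<close>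

lemma maximal_inequality:
  assumes y: "\<phi> y = 0" and \<epsilon>: "\<epsilon> > 0"
  shows "emeasure \<Omega> {\<omega>. \<exists>k. dist (orbit T \<omega> z k) y \<ge> \<epsilon>} \<le> ennreal ((dist z y)\<^sup>2 / \<epsilon>\<^sup>2)"
proof -
  \<comment> \<open>A finite horizon permits induction; continuity from below then removes
    it.\<close>
  define B where "B N z = {\<omega>. \<exists>k<N. dist (orbit T \<omega> z k) y \<ge> \<epsilon>}" for N z
  have B_sets [measurable]: "B N z \<in> sets \<Omega>" for N z
    unfolding B_def by (rule sets_Collect_paths) measurable
  have "emeasure \<Omega> (B N z) \<le> ennreal ((dist z y)\<^sup>2 / \<epsilon>\<^sup>2)" for N z
  proof (induction N arbitrary: z)
    case 0
    then show ?case by (simp add: B_def)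
  next
    case (Suc N)
    show ?case
    proof (cases "dist z y \<ge> \<epsilon>")
      case True
      then have "1 \<le> (dist z y)\<^sup>2 / \<epsilon>\<^sup>2"
        using \<epsilon> by (simp add: power_mono)
      then have "1 \<le> ennreal ((dist z y)\<^sup>2 / \<epsilon>\<^sup>2)"
        by simp
      then show ?thesis
        using paths.emeasure_le_1[of "B (Suc N) z"]
          order_trans by blast
    next
      case False
      \<comment> \<open>The start itself is closer than \<open>\<epsilon>\<close> to
        \<open>y\<close>, so the event can only occur after the first step, with one step less in
        the horizon.\<close>
      have split: "(i ## \<omega>) \<in> B (Suc N) z \<longleftrightarrow> \<omega> \<in> B N (T i z)" for i \<omega>
        unfolding B_def mem_Collect_eq Ex_less_Suc2
        using False by (simp add: orbit_SCons del: orbit.simps(2))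
      have "emeasure \<Omega> (B (Suc N) z) = (\<integral>\<^sup>+i. emeasure \<Omega> (B N (T i z)) \<partial>measure_pmf p)"
        by (subst prob_space.emeasure_stream_space[OF prob_space_measure_pmf]) (simp_all add: split)
      also have "\<dots> \<le> (\<integral>\<^sup>+i. ennreal ((dist (T i z) y)\<^sup>2 / \<epsilon>\<^sup>2) \<partial>measure_pmf p)"
        by (intro nn_integral_mono Suc)
      also have "\<dots> = (\<integral>\<^sup>+i. ennreal ((dist (T i z) y)\<^sup>2) * ennreal (1 / \<epsilon>\<^sup>2) \<partial>measure_pmf p)"
        by (simp add: ennreal_mult[symmetric])
      also have "\<dots> = (\<integral>\<^sup>+i. ennreal ((dist (T i z) y)\<^sup>2) \<partial>measure_pmf p) * ennreal (1 / \<epsilon>\<^sup>2)"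
        by (rule nn_integral_multc) simp
      also have "\<dots> \<le> ennreal ((dist z y)\<^sup>2) * ennreal (1 / \<epsilon>\<^sup>2)"
        by (intro mult_right_mono descent_dist y) simp
      also have "\<dots> = ennreal ((dist z y)\<^sup>2 / \<epsilon>\<^sup>2)"
        by (simp add: ennreal_mult[symmetric])
      finally show ?thesis .
    qed
  qed
  moreover have "(\<lambda>N. emeasure \<Omega> (B N z)) \<longlonglongrightarrow> emeasure \<Omega> (\<Union>N. B N z)"
  proof (rule Lim_emeasure_incseq)
    show "range (\<lambda>N. B N z) \<subseteq> sets \<Omega>"
      using B_sets by blast
    show "incseq (\<lambda>N. B N z)"
      unfolding incseq_def B_def using less_le_trans by blast
  qed
  ultimately have "emeasure \<Omega> (\<Union>N. B N z) \<le> ennreal ((dist z y)\<^sup>2 / \<epsilon>\<^sup>2)"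
    by (intro LIMSEQ_le_const2) auto
  moreover have "(\<Union>N. B N z) = {\<omega>. \<exists>k. dist (orbit T \<omega> z k) y \<ge> \<epsilon>}"
    by (auto simp: B_def)
  ultimately show ?thesis by simp
qed

text \<open>By the maximal inequality the orbit leaves the ball of radius \<open>R + 1\<close>
  around \<open>y\<close> with probability of order \<open>1 / (R + 1)^2\<close>; leaving all these
  balls is thus a null event.\<close>

lemma AE_bounded: "AE \<omega> in \<Omega>. bounded (range (orbit T \<omega> z))"
proof -
  obtain y where y: "\<phi> y = 0" using zero_exists by blast
  define B where "B R = {\<omega>. \<exists>k. dist (orbit T \<omega> z k) y \<ge> real (Suc R)}" for R
  have B_sets [measurable]: "B R \<in> sets \<Omega>" for R
    unfolding B_def by (rule sets_Collect_paths) measurable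
  have le: "emeasure \<Omega> (\<Inter>R. B R) \<le> ennreal ((dist z y)\<^sup>2 / (real (Suc R))\<^sup>2)" for R
  proof -
    have "emeasure \<Omega> (\<Inter>R. B R) \<le> emeasure \<Omega> (B R)"
      by (intro emeasure_mono) auto
    also have "\<dots> \<le> ennreal ((dist z y)\<^sup>2 / (real (Suc R))\<^sup>2)"
      unfolding B_def by (rule maximal_inequality[OF y]) simp
    finally show ?thesis .
  qed
  have "(\<lambda>R. (dist z y)\<^sup>2 / (real (Suc R))\<^sup>2) \<longlonglongrightarrow> 0"
    by real_asymp
  then have "(\<lambda>R. ennreal ((dist z y)\<^sup>2 / (real (Suc R))\<^sup>2)) \<longlonglongrightarrow> ennreal 0"
    by (rule tendsto_ennrealI)
  then have "emeasure \<Omega> (\<Inter>R. B R) \<le> ennreal 0"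
    by (rule LIMSEQ_le_const) (use le in auto)
  then have "(\<Inter>R. B R) \<in> null_sets \<Omega>"
    by (intro null_setsI) auto
  then have "AE \<omega> in \<Omega>. \<omega> \<notin> (\<Inter>R. B R)"
    by (rule AE_not_in)
  then show ?thesis
  proof eventually_elim
    case (elim \<omega>)
    then obtain R where "\<And>k. dist (orbit T \<omega> z k) y < real (Suc R)"
      unfolding B_def by (auto simp: not_le)
    then have "range (orbit T \<omega> z) \<subseteq> ball y (real (Suc R))"
      by (auto simp: dist_commute)
    then show ?case
      by (rule bounded_subset[OF bounded_ball])
  qed
qed

text \<open>A compactness argument on each path: on the points of a bounding ball at distance at
  least \<open>e\<close> from the zeros, \<open>\<phi>\<close> has a positive minimum, so an orbit
  along which \<open>\<phi>\<close> tends to 0 eventually avoids them.\<close>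

lemma AE_infdist_tendsto_0: "AE \<omega> in \<Omega>. (\<lambda>k. infdist (orbit T \<omega> z k) zeros) \<longlonglongrightarrow> 0"
  using AE_gap_tendsto_0[of z] AE_bounded[of z]
proof eventually_elim
  case (elim \<omega>)
  let ?x = "orbit T \<omega> z"
  obtain R where R: "\<And>k. ?x k \<in> cball 0 R"
    using elim(2) by (auto simp: bounded_iff)
  show ?case
  proof (rule order_tendstoI)
    fix e :: real assume "e < 0"
    then show "\<forall>\<^sub>F k in sequentially. e < infdist (?x k) zeros"
      by (intro always_eventually allI) (meson infdist_nonneg less_le_trans)
  next
    fix e :: real assume e: "0 < e"
    define K where "K = cball 0 R \<inter> {u. e \<le> infdist u zeros}"
    have K: "compact K" unfolding K_def
      by (intro compact_Int_closed closed_Collect_le continuous_intros) auto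
    show "\<forall>\<^sub>F k in sequentially. infdist (?x k) zeros < e"
    proof (cases "K = {}")
      case True
      then show ?thesis using R unfolding K_def
        by (intro always_eventually allI) (metis (no_types, lifting) IntI empty_iff mem_Collect_eq not_le)
    next
      case False
      obtain c where c: "c \<in> K" "\<And>u. u \<in> K \<Longrightarrow> \<phi> c \<le> \<phi> u"
        using continuous_attains_inf[OF K False continuous_on_subset[OF continuous_gap]] by auto
      have "\<phi> c \<noteq> 0"
      proof
        assume "\<phi> c = 0"
        then have "infdist c zeros = 0" by simp
        then show False using c(1) e by (simp add: K_def)
      qed
      then have "0 < \<phi> c" using gap_nonneg[of c] by simp
      then have "\<forall>\<^sub>F k in sequentially. \<phi> (?x k) < \<phi> c"
        using elim(1) by (rule order_tendstoD(2)[rotated])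
      then show ?thesis
      proof eventually_elim
        case (elim k)
        then have "?x k \<notin> K" using c(2) by (meson not_le)
        then show ?case using R[of k] by (simp add: K_def not_le)
      qed
    qed
  qed
qed

section \<open>Oscillation at infinity and the Cauchy property\<close>

lemma measurable_infdist_zeros [measurable]: "(\<lambda>u. infdist u zeros) \<in> borel_measurable borel"
  by (intro borel_measurable_continuous_onI continuous_intros)

text \<open>Induction on \<open>n\<close> carries out the restart, one letter at a time. The nearest
  zero is chosen in the base case only, where the starting point is deterministic; it is a constant
  there, as the maximal inequality requires.\<close>

lemma emeasure_oscillation_le:
  assumes \<epsilon>: "\<epsilon> > 0"
  shows "emeasure \<Omega> {\<omega>. \<not> (\<exists>N. \<forall>k\<ge>N. \<forall>l\<ge>N. dist (orbit T \<omega> z k) (orbit T \<omega> z l) < 2 * \<epsilon>)}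
    \<le> (\<integral>\<^sup>+\<omega>. min 1 (ennreal ((infdist (orbit T \<omega> z n) zeros)\<^sup>2 / \<epsilon>\<^sup>2)) \<partial>\<Omega>)"
proof -
  define C where
    "C z = {\<omega>. \<not> (\<exists>N. \<forall>k\<ge>N. \<forall>l\<ge>N. dist (orbit T \<omega> z k) (orbit T \<omega> z l) < 2 * \<epsilon>)}" for z
  have C_sets [measurable]: "C z \<in> sets \<Omega>" for z
    unfolding C_def by (rule sets_Collect_paths) measurable
  \<comment> \<open>Oscillation is a tail event: it concerns arbitrarily late indices, so deleting
    the first step does not change it.\<close>
  have shift: "(i ## \<omega>) \<in> C z \<longleftrightarrow> \<omega> \<in> C (T i z)" for i \<omega> z
  proof -
    have "(\<exists>N. \<forall>k\<ge>N. \<forall>l\<ge>N. dist (orbit T (i ## \<omega>) z k) (orbit T (i ## \<omega>) z l) < 2 * \<epsilon>)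
      \<longleftrightarrow> (\<exists>N. \<forall>k\<ge>N. \<forall>l\<ge>N. dist (orbit T (i ## \<omega>) z (Suc k)) (orbit T (i ## \<omega>) z (Suc l)) < 2 * \<epsilon>)"
      (is "?L = ?R")
    proof
      assume ?L then show ?R by (metis le_SucI)
    next
      assume ?R
      then obtain N where "\<forall>k\<ge>N. \<forall>l\<ge>N. dist (orbit T (i ## \<omega>) z (Suc k)) (orbit T (i ## \<omega>) z (Suc l)) < 2 * \<epsilon>"
        by blast
      then show ?L by (intro exI[of _ "Suc N"]) (metis Suc_le_D Suc_le_mono)
    qed
    then show ?thesis
      unfolding C_def mem_Collect_eq orbit_SCons by (rule arg_cong[where f = Not])
  qed
  have "emeasure \<Omega> (C z) \<le> (\<integral>\<^sup>+\<omega>. min 1 (ennreal ((infdist (orbit T \<omega> z n) zeros)\<^sup>2 / \<epsilon>\<^sup>2)) \<partial>\<Omega>)"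
  proof (induction n arbitrary: z)
    case 0
    obtain y where y: "\<phi> y = 0" and dist_y: "infdist z zeros = dist z y"
      using infdist_attains_inf[OF closed_zeros, of z] zero_exists by auto
    \<comment> \<open>If the orbit stays within \<open>\<epsilon>\<close> of \<open>y\<close>, any
      two of its points are less than \<open>2 * \<epsilon>\<close> apart.\<close>
    have "C z \<subseteq> {\<omega>. \<exists>k. dist (orbit T \<omega> z k) y \<ge> \<epsilon>}"
    proof (rule subsetI, rule ccontr)
      fix \<omega> assume "\<omega> \<in> C z" and "\<omega> \<notin> {\<omega>. \<exists>k. dist (orbit T \<omega> z k) y \<ge> \<epsilon>}"
      then have "dist (orbit T \<omega> z k) y < \<epsilon>" for k
        by (auto simp: not_le)
      then have "dist (orbit T \<omega> z k) (orbit T \<omega> z l) < 2 * \<epsilon>" for k l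
        using dist_triangle2[of "orbit T \<omega> z k" "orbit T \<omega> z l" y] by (smt (verit))
      with \<open>\<omega> \<in> C z\<close> show False by (auto simp: C_def)
    qed
    then have "emeasure \<Omega> (C z) \<le> emeasure \<Omega> {\<omega>. \<exists>k. dist (orbit T \<omega> z k) y \<ge> \<epsilon>}"
    proof (rule emeasure_mono)
      show "{\<omega>. \<exists>k. dist (orbit T \<omega> z k) y \<ge> \<epsilon>} \<in> sets \<Omega>"
        by (rule sets_Collect_paths) measurable
    qed
    also have "\<dots> \<le> ennreal ((infdist z zeros)\<^sup>2 / \<epsilon>\<^sup>2)"
      using maximal_inequality[OF y \<epsilon>] by (simp add: dist_y)
    finally have "emeasure \<Omega> (C z) \<le> min 1 (ennreal ((infdist z zeros)\<^sup>2 / \<epsilon>\<^sup>2))"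
      using paths.emeasure_le_1 by simp
    then show ?case
      using paths.emeasure_space_1 by simp
  next
    case (Suc n)
    have "emeasure \<Omega> (C z) = (\<integral>\<^sup>+i. emeasure \<Omega> (C (T i z)) \<partial>measure_pmf p)"
      by (subst prob_space.emeasure_stream_space[OF prob_space_measure_pmf]) (simp_all add: shift)
    also have "\<dots> \<le> (\<integral>\<^sup>+i. \<integral>\<^sup>+\<omega>. min 1 (ennreal ((infdist (orbit T \<omega> (T i z) n) zeros)\<^sup>2 / \<epsilon>\<^sup>2)) \<partial>\<Omega> \<partial>measure_pmf p)"
      by (intro nn_integral_mono Suc)
    also have "\<dots> = (\<integral>\<^sup>+\<omega>. min 1 (ennreal ((infdist (orbit T \<omega> z (Suc n)) zeros)\<^sup>2 / \<epsilon>\<^sup>2)) \<partial>\<Omega>)"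
      by (subst (2) prob_space.nn_integral_stream_space[OF prob_space_measure_pmf]) (simp_all add: orbit_SCons del: orbit.simps(2))
    finally show ?case .
  qed
  then show ?thesis by (simp add: C_def)
qed

lemma AE_Cauchy: "AE \<omega> in \<Omega>. Cauchy (orbit T \<omega> z)"
proof -
  define osc where "osc \<epsilon> \<omega> \<longleftrightarrow>
    \<not> (\<exists>N. \<forall>k\<ge>N. \<forall>l\<ge>N. dist (orbit T \<omega> z k) (orbit T \<omega> z l) < 2 * \<epsilon>)" for \<epsilon> \<omega>
  have "AE \<omega> in \<Omega>. \<not> osc \<epsilon> \<omega>" if \<epsilon>: "\<epsilon> > 0" for \<epsilon>
  proof -
    \<comment> \<open>The truncation at 1 supplies the dominating function; almost sure convergence
      alone would not carry over to the integrals.\<close>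
    let ?u = "\<lambda>n \<omega>. min 1 (ennreal ((infdist (orbit T \<omega> z n) zeros)\<^sup>2 / \<epsilon>\<^sup>2))"
    have "(\<lambda>n. \<integral>\<^sup>+\<omega>. ?u n \<omega> \<partial>\<Omega>) \<longlonglongrightarrow> (\<integral>\<^sup>+\<omega>. 0 \<partial>\<Omega>)"
    proof (rule nn_integral_dominated_convergence[where w = "\<lambda>_. 1"])
      show "(\<integral>\<^sup>+\<omega>. 1 \<partial>\<Omega>) < \<infinity>"
        using paths.emeasure_space_1 by simp
      show "AE \<omega> in \<Omega>. (\<lambda>n. ?u n \<omega>) \<longlonglongrightarrow> 0"
        using AE_infdist_tendsto_0[of z]
      proof eventually_elim
        case (elim \<omega>)
        have "(\<lambda>n. (infdist (orbit T \<omega> z n) zeros)\<^sup>2 / \<epsilon>\<^sup>2) \<longlonglongrightarrow> 0\<^sup>2 / \<epsilon>\<^sup>2"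
          by (intro tendsto_intros elim) (use \<epsilon> in simp)
        then have "(\<lambda>n. ?u n \<omega>) \<longlonglongrightarrow> min 1 (ennreal (0\<^sup>2 / \<epsilon>\<^sup>2))"
          by (intro tendsto_min tendsto_const tendsto_ennrealI)
        then show ?case by simp
      qed
    qed simp_all
    then have "emeasure \<Omega> {\<omega>. osc \<epsilon> \<omega>} \<le> (\<integral>\<^sup>+\<omega>. 0 \<partial>\<Omega>)"
      using emeasure_oscillation_le[OF \<epsilon>, of z] unfolding osc_def by (intro LIMSEQ_le_const) auto
    moreover have "{\<omega>. osc \<epsilon> \<omega>} \<in> sets \<Omega>"
      unfolding osc_def by (rule sets_Collect_paths) measurable
    ultimately have "{\<omega>. osc \<epsilon> \<omega>} \<in> null_sets \<Omega>"
      by (intro null_setsI) auto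
    then show ?thesis
      by (rule AE_not_in[THEN eventually_mono]) simp
  qed
  \<comment> \<open>Countably many sizes suffice for the Cauchy property and leave a single null
    set.\<close>
  then have "AE \<omega> in \<Omega>. \<forall>m. \<not> osc (1 / real (Suc m)) \<omega>"
    unfolding AE_all_countable by simp
  then show ?thesis
  proof eventually_elim
    case (elim \<omega>)
    show ?case
    proof (rule metric_CauchyI)
      fix e :: real assume "0 < e"
      then obtain m where m: "1 / real (Suc m) < e / 2"
        using nat_approx_posE[of "e / 2"] by auto
      obtain N where N: "\<And>k l. k \<ge> N \<Longrightarrow> l \<ge> N \<Longrightarrow>
          dist (orbit T \<omega> z k) (orbit T \<omega> z l) < 2 * (1 / real (Suc m))"
        using elim[rule_format, of m] unfolding osc_def not_not by blast
      show "\<exists>N. \<forall>k\<ge>N. \<forall>l\<ge>N. dist (orbit T \<omega> z k) (orbit T \<omega> z l) < e"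
      proof (intro exI[of _ N] allI impI)
        fix k l assume "k \<ge> N" "l \<ge> N"
        from N[OF this] m show "dist (orbit T \<omega> z k) (orbit T \<omega> z l) < e" by argo
      qed
    qed
  qed
qed

theorem AE_orbit_converges: "AE \<omega> in \<Omega>. \<exists>y. \<phi> y = 0 \<and> orbit T \<omega> z \<longlonglongrightarrow> y"
  using AE_Cauchy[of z] AE_gap_tendsto_0[of z]
proof eventually_elim
  case (elim \<omega>)
  then obtain y where y: "orbit T \<omega> z \<longlonglongrightarrow> y"
    by (auto simp: Cauchy_convergent_iff convergent_def)
  then have "(\<lambda>k. \<phi> (orbit T \<omega> z k)) \<longlonglongrightarrow> \<phi> y"
    using continuous_gap by (simp add: continuous_on_eq_continuous_at isCont_tendsto_compose)
  then have "\<phi> y = 0" using elim(2) LIMSEQ_unique by blast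
  with y show ?case by blast
qed

text \<open>Fubini: an event that is null for every fixed start is null for the product law,
  provided that it is measurable.\<close>

corollary AE_orbit_converges_pair:
  assumes "prob_space \<mu>" and sets_\<mu>: "sets \<mu> = sets borel"
  shows "AE (z, \<omega>) in \<mu> \<Otimes>\<^sub>M \<Omega>. \<exists>y. \<phi> y = 0 \<and> orbit T \<omega> z \<longlonglongrightarrow> y"
proof -
  interpret P: prob_space \<mu> by fact
  interpret pair_sigma_finite \<mu> \<Omega> ..
  \<comment> \<open>By completeness the existential over limits becomes a condition on
    \<open>Cauchy\<close> and \<open>lim\<close>, whose measurability is available.\<close>
  have eq: "(\<exists>y. \<phi> y = 0 \<and> orbit T \<omega> z \<longlonglongrightarrow> y) \<longleftrightarrow>
      Cauchy (orbit T \<omega> z) \<and> \<phi> (lim (orbit T \<omega> z)) = 0" for \<omega> z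
    by (auto simp: Cauchy_convergent_iff convergent_LIMSEQ_iff limI intro: convergentI)
  have [measurable]: "(\<lambda>w. orbit T (snd w) (fst w) k) \<in> borel_measurable (\<mu> \<Otimes>\<^sub>M \<Omega>)" for k
    using measurable_orbit_pair[of k] sets_\<mu>
    by (simp add: case_prod_unfold cong: measurable_cong_sets)
  have "{w \<in> space (\<mu> \<Otimes>\<^sub>M \<Omega>). Cauchy (orbit T (snd w) (fst w)) \<and> \<phi> (lim (orbit T (snd w) (fst w))) = 0}
      \<in> sets (\<mu> \<Otimes>\<^sub>M \<Omega>)"
  proof (rule sets.sets_Collect_conj)
    show "{w \<in> space (\<mu> \<Otimes>\<^sub>M \<Omega>). Cauchy (orbit T (snd w) (fst w))} \<in> sets (\<mu> \<Otimes>\<^sub>M \<Omega>)"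
      by (rule sets_Collect_Cauchy) measurable
    have "(\<lambda>w. lim (orbit T (snd w) (fst w))) \<in> borel_measurable (\<mu> \<Otimes>\<^sub>M \<Omega>)"
      by (rule borel_measurable_lim_metric) measurable
    then have "(\<lambda>w. \<phi> (lim (orbit T (snd w) (fst w)))) \<in> borel_measurable (\<mu> \<Otimes>\<^sub>M \<Omega>)"
      by (rule measurable_compose[OF _ measurable_gap])
    then show "{w \<in> space (\<mu> \<Otimes>\<^sub>M \<Omega>). \<phi> (lim (orbit T (snd w) (fst w))) = 0} \<in> sets (\<mu> \<Otimes>\<^sub>M \<Omega>)"
      by (rule borel_measurable_eq) simp
  qed
  moreover have "AE z in \<mu>. AE \<omega> in \<Omega>. Cauchy (orbit T \<omega> z) \<and> \<phi> (lim (orbit T \<omega> z)) = 0"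
    using AE_orbit_converges unfolding eq by (rule AE_I2)
  ultimately show ?thesis
    unfolding case_prod_unfold eq by (intro AE_pair_measure) simp_all
qed

end

subsection \<open>The joint law of the initial point and the activations\<close>

text \<open>Independence is the product formula on rectangles, and this determines the product of
  two sigma-finite measures.\<close>

lemma (in prob_space) indep_rvs_distr_pair:
  assumes "indep_rvs M N X N' Y"
  shows "distr M (N \<Otimes>\<^sub>M N') (\<lambda>\<omega>. (X \<omega>, Y \<omega>)) = distr M N X \<Otimes>\<^sub>M distr M N' Y"
proof -
  have X[measurable]: "X \<in> measurable M N" and Y[measurable]: "Y \<in> measurable M N'"
    and ind: "indep_set {X -` S \<inter> space M |S. S \<in> sets N} {Y -` S \<inter> space M |S. S \<in> sets N'}"
    using assms by (auto simp: indep_rvs_def)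
  show ?thesis
  proof (rule pair_measure_eqI[symmetric])
    show "sigma_finite_measure (distr M N X)" "sigma_finite_measure (distr M N' Y)"
      by (intro prob_space_imp_sigma_finite prob_space_distr X Y)+
    show "sets (distr M N X \<Otimes>\<^sub>M distr M N' Y) = sets (distr M (N \<Otimes>\<^sub>M N') (\<lambda>\<omega>. (X \<omega>, Y \<omega>)))"
      by (simp cong: sets_pair_measure_cong)
    fix S S' assume "S \<in> sets (distr M N X)" "S' \<in> sets (distr M N' Y)"
    then have [measurable]: "S \<in> sets N" "S' \<in> sets N'" by auto
    have "prob ((X -` S \<inter> space M) \<inter> (Y -` S' \<inter> space M))
        = prob (X -` S \<inter> space M) * prob (Y -` S' \<inter> space M)"
      by (rule indep_setD[OF ind]) auto
    moreover have "(X -` S \<inter> space M) \<inter> (Y -` S' \<inter> space M) = (\<lambda>\<omega>. (X \<omega>, Y \<omega>)) -` (S \<times> S') \<inter> space M"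
      by auto
    ultimately show "emeasure (distr M N X) S * emeasure (distr M N' Y) S'
        = emeasure (distr M (N \<Otimes>\<^sub>M N') (\<lambda>\<omega>. (X \<omega>, Y \<omega>))) (S \<times> S')"
      by (simp add: emeasure_distr emeasure_eq_measure ennreal_mult[symmetric])
  qed
qed

lemma (in prob_space) indep_rvs_compose:
  assumes "indep_rvs M N X N' Y" and g: "g \<in> measurable N' K"
  shows "indep_rvs M N X K (\<lambda>\<omega>. g (Y \<omega>))"
proof -
  have Y[measurable]: "Y \<in> measurable M N'"
    using assms(1) by (simp add: indep_rvs_def)
  have "{(\<lambda>\<omega>. g (Y \<omega>)) -` S \<inter> space M |S. S \<in> sets K} \<subseteq> {Y -` S \<inter> space M |S. S \<in> sets N'}"
  proof clarify
    fix S assume "S \<in> sets K"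
    then have "g -` S \<inter> space N' \<in> sets N'"
      by (rule measurable_sets[OF g])
    moreover have "(\<lambda>\<omega>. g (Y \<omega>)) -` S \<inter> space M = Y -` (g -` S \<inter> space N') \<inter> space M"
      using measurable_space[OF Y] by auto
    ultimately show "\<exists>S'. (\<lambda>\<omega>. g (Y \<omega>)) -` S \<inter> space M = Y -` S' \<inter> space M \<and> S' \<in> sets N'"
      by blast
  qed
  moreover have "(\<lambda>\<omega>. g (Y \<omega>)) \<in> measurable M K"
    using Y g by (rule measurable_compose)
  ultimately show ?thesis
    using assms(1) unfolding indep_rvs_def indep_sets2_eq by (meson subset_iff)
qed

text \<open>Activations are numbered from 1 and stream letters from 0, hence the shift by
  \<open>Suc\<close>.\<close>

lemma measurable_to_stream_Suc:
  "(\<lambda>f. to_stream (\<lambda>k. f (Suc k)))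
    \<in> measurable (\<Pi>\<^sub>M k\<in>{1..}. count_space UNIV) (stream_space (measure_pmf p))"
proof (rule measurable_stream_space2)
  fix n
  have "(\<lambda>f. f (Suc n)) \<in> measurable (\<Pi>\<^sub>M k\<in>{1..}. count_space UNIV) (count_space UNIV)"
    by (rule measurable_component_singleton) simp
  then show "(\<lambda>f. to_stream (\<lambda>k. f (Suc k)) !! n)
      \<in> measurable (\<Pi>\<^sub>M k\<in>{1..}. count_space UNIV) (measure_pmf p)"
    by (simp add: to_stream_def cong: measurable_cong_sets)
qed

text \<open>Independence makes the law of the family a product over the indices from 1 on;
  reindexing by \<open>Suc\<close> gives the product over all naturals, whose image under
  \<open>to_stream\<close> is the stream space.\<close>

lemma (in prob_space) distr_to_stream_Suc:
  assumes ind: "indep_vars (\<lambda>_. count_space UNIV) \<xi> {1::nat..}"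
    and law: "\<And>k. k \<ge> 1 \<Longrightarrow> distr M (count_space UNIV) (\<xi> k) = measure_pmf p"
  shows "distr M (stream_space (measure_pmf p)) (\<lambda>\<omega>. to_stream (\<lambda>k. \<xi> (Suc k) \<omega>))
    = stream_space (measure_pmf p)"
proof -
  let ?C = "\<Pi>\<^sub>M k\<in>{1::nat..}. count_space UNIV"
  let ?P = "\<Pi>\<^sub>M k\<in>{1::nat..}. measure_pmf p"
  let ?S = "stream_space (measure_pmf p)"
  let ?\<xi> = "\<lambda>\<omega>. \<lambda>k\<in>{1..}. \<xi> k \<omega>"
  have rv: "\<xi> k \<in> measurable M (count_space UNIV)" if "k \<in> {1..}" for k
    using ind that by (auto simp: indep_vars_def)
  have "distr M ?C ?\<xi> = (\<Pi>\<^sub>M k\<in>{1..}. distr M (count_space UNIV) (\<xi> k))"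
    by (rule iffD1[OF indep_vars_iff_distr_eq_PiM'[OF _ rv] ind]) simp_all
  also have "\<dots> = ?P"
    by (intro PiM_cong) (auto simp: law)
  finally have P: "distr M ?C ?\<xi> = ?P" .
  have \<xi>: "?\<xi> \<in> measurable M ?C"
    by (rule measurable_restrict) (rule rv)
  have "distr M ?S (\<lambda>\<omega>. to_stream (\<lambda>k. \<xi> (Suc k) \<omega>))
      = distr (distr M ?C ?\<xi>) ?S (\<lambda>f. to_stream (\<lambda>k. f (Suc k)))"
    by (subst distr_distr[OF measurable_to_stream_Suc \<xi>]) (simp add: comp_def)
  \<comment> \<open>Restriction to \<open>UNIV\<close> is the identity; it is inserted to match the
    form of \<open>distr_PiM_reindex\<close>.\<close>
  also have "\<dots> = distr ?P ?S (to_stream \<circ> (\<lambda>f. \<lambda>k\<in>UNIV. f (Suc k)))"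
    unfolding P by (simp add: comp_def restrict_def)
  also have "\<dots> = distr (distr ?P (\<Pi>\<^sub>M k\<in>UNIV. measure_pmf p) (\<lambda>f. \<lambda>k\<in>UNIV. f (Suc k))) ?S to_stream"
    by (rule distr_distr[symmetric])
      (auto intro!: measurable_restrict measurable_component_singleton)
  also have "distr ?P (\<Pi>\<^sub>M k\<in>UNIV. measure_pmf p) (\<lambda>f. \<lambda>k\<in>UNIV. f (Suc k)) = (\<Pi>\<^sub>M k\<in>UNIV. measure_pmf p)"
    by (rule distr_PiM_reindex) (auto simp: prob_space_measure_pmf)
  finally show ?thesis
    by (simp add: stream_space_eq_distr[symmetric])
qed

subsection \<open>Distance to a convex set and block gradients\<close>

text \<open>For closed, convex, nonempty \<open>C\<close> this is the gradient of half the squared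
  distance to \<open>C\<close>.\<close>

definition residual :: "'a::euclidean_space set \<Rightarrow> 'a \<Rightarrow> 'a" where
  "residual C x = x - closest_point C x"

context
  fixes C :: "'a::euclidean_space set"
  assumes C: "convex C" "closed C" "C \<noteq> {}"
begin

lemma sqdist_eq: "sqdist C x = (norm (residual C x))\<^sup>2"
  unfolding sqdist_def residual_def
proof (rule cInf_eq_minimum)
  show "(norm (x - closest_point C x))\<^sup>2 \<in> (\<lambda>y. (norm (x - y))\<^sup>2) ` C"
    using closest_point_in_set[OF C(2,3)] by blast
  fix t assume "t \<in> (\<lambda>y. (norm (x - y))\<^sup>2) ` C"
  then obtain y where y: "y \<in> C" "t = (norm (x - y))\<^sup>2" by blast
  then show "(norm (x - closest_point C x))\<^sup>2 \<le> t"
    using closest_point_le[OF C(2) y(1), of x] by (simp add: dist_norm power_mono)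
qed

lemma sqdist_le: "y \<in> C \<Longrightarrow> sqdist C x \<le> (norm (x - y))\<^sup>2"
  using closest_point_le[OF C(2), of y x] by (simp add: sqdist_eq residual_def dist_norm power_mono)

text \<open>Add the obtuse-angle inequalities of the projection at \<open>x\<close> and at
  \<open>y\<close>, and split \<open>x - y\<close> into the differences of residuals and of
  projections.\<close>

lemma residual_firmly_nonexpansive:
  "(norm (residual C x - residual C y))\<^sup>2 \<le> inner (residual C x - residual C y) (x - y)"
proof -
  let ?P = "closest_point C"
  have "inner (x - ?P x) (?P y - ?P x) \<le> 0" "inner (y - ?P y) (?P x - ?P y) \<le> 0"
    using closest_point_dot[OF C(1,2)] closest_point_in_set[OF C(2,3)] by blast+
  then show ?thesis
    by (simp add: residual_def power2_norm_eq_inner inner_diff_left inner_diff_right inner_commute)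
qed

text \<open>The subgradient inequality. In \<open>y - x\<close> the projection part contributes
  nonpositively by the obtuse angle, and the residual part is controlled by expanding the square of
  the residual difference.\<close>

lemma half_sqdist_lower:
  "1/2 * sqdist C x + inner (residual C x) (y - x) \<le> 1/2 * sqdist C y"
proof -
  let ?P = "closest_point C"
  have 1: "inner (residual C x) (?P y - ?P x) \<le> 0"
    using closest_point_dot[OF C(1,2)] closest_point_in_set[OF C(2,3)]
    unfolding residual_def by blast
  have 2: "0 \<le> (norm (residual C y - residual C x))\<^sup>2" by simp
  have "y - x = (residual C y - residual C x) + (?P y - ?P x)"
    by (simp add: residual_def)
  then have 3: "inner (residual C x) (y - x)
      = inner (residual C x) (residual C y - residual C x) + inner (residual C x) (?P y - ?P x)"
    by (metis inner_add_right)
  show ?thesis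
    using 1 2 unfolding 3 sqdist_eq
    by (simp add: power2_norm_eq_inner inner_diff_left inner_diff_right inner_commute)
qed

text \<open>The projection of \<open>x\<close> is a competitor for the distance from
  \<open>y\<close> to \<open>C\<close>.\<close>

lemma half_sqdist_upper:
  "1/2 * sqdist C y \<le> 1/2 * sqdist C x + inner (residual C x) (y - x) + 1/2 * (norm (y - x))\<^sup>2"
proof -
  have "sqdist C y \<le> (norm (y - closest_point C x))\<^sup>2"
    by (intro sqdist_le closest_point_in_set C)
  also have "y - closest_point C x = residual C x + (y - x)"
    by (simp add: residual_def)
  finally show ?thesis
    unfolding sqdist_eq[of x]
    by (simp add: power2_norm_eq_inner inner_add_left inner_add_right inner_commute)
qed

lemma continuous_on_residual: "continuous_on UNIV (residual C)"
  unfolding residual_def by (intro continuous_intros continuous_on_closest_point C)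

end

text \<open>The triangle inequality through the projection; it turns a bound on the cost into a
  bound on positions.\<close>

lemma norm_le_sqrt_sqdist:
  fixes v c :: "'a::euclidean_space"
  assumes "0 \<le> \<rho>"
  shows "norm (v - c) \<le> \<rho> + sqrt (sqdist (cball c \<rho>) v)"
proof -
  have "closest_point (cball c \<rho>) v \<in> cball c \<rho>"
    using assms by (intro closest_point_in_set) auto
  then have "norm (closest_point (cball c \<rho>) v - c) \<le> \<rho>"
    by (simp add: dist_norm norm_minus_commute)
  moreover have "norm (v - closest_point (cball c \<rho>) v) = sqrt (sqdist (cball c \<rho>) v)"
    using assms by (subst sqdist_eq) (auto simp: residual_def)
  ultimately show ?thesis
    using norm_triangle_ineq[of "v - closest_point (cball c \<rho>) v" "closest_point (cball c \<rho>) v - c"]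
    by simp
qed

text \<open>Divided by the distance, the remainder is at most \<open>K\<close> times the distance,
  so two-sided quadratic bounds already give differentiability.\<close>

lemma gderiv_quadratic_bound:
  fixes f :: "'a::real_inner \<Rightarrow> real"
  assumes "\<And>y. \<bar>f y - f x - inner g (y - x)\<bar> \<le> K * (norm (y - x))\<^sup>2"
  shows "GDERIV f x :> g"
  unfolding gderiv_def
proof (rule has_derivativeI_sandwich[where e = 1 and H = "\<lambda>y. K * norm (y - x)"])
  show "bounded_linear (\<lambda>h. inner h g)" by (rule bounded_linear_inner_left)
  show "((\<lambda>y. K * norm (y - x)) \<longlongrightarrow> 0) (at x)"
    by (rule tendsto_eq_intros | simp)+
  fix y :: 'a assume "y \<noteq> x"
  then show "norm (f y - f x - inner (y - x) g) / norm (y - x) \<le> K * norm (y - x)"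
    using assms[of y] by (simp add: divide_le_eq power2_eq_square inner_commute mult.assoc)
qed simp

lemma mem_minimizers_iff:
  assumes "bdd_below (range f)"
  shows "x \<in> minimizers f \<longleftrightarrow> (\<forall>y. f x \<le> (f y :: real))"
proof
  assume "x \<in> minimizers f"
  then show "\<forall>y. f x \<le> f y"
    using cINF_lower[OF assms] by (simp add: minimizers_def)
next
  assume "\<forall>y. f x \<le> f y"
  then have "Inf (range f) = f x"
    by (intro cInf_eq_minimum) auto
  then show "x \<in> minimizers f"
    by (simp add: minimizers_def)
qed

lemma norm_power2_vec: "(norm x)\<^sup>2 = (\<Sum>i\<in>UNIV. (norm (x $ i))\<^sup>2)" for x :: "'a::real_inner ^ 'n::finite"
  by (simp add: power2_norm_eq_inner inner_vec_def)

lemma set_block_eq_axis: "set_block x i z = x + axis i (z - x $ i)" for x :: "'a::real_inner ^ 'n::finite"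
  by (simp add: set_block_def vec_eq_iff axis_def)

lemma norm_axis: "norm (axis i v) = norm v" for v :: "'a::real_inner"
  by (simp add: norm_eq_sqrt_inner inner_axis_axis)

lemma continuous_on_axis [continuous_intros]:
  fixes g :: "'b::topological_space \<Rightarrow> 'c::real_normed_vector"
  assumes "continuous_on S g"
  shows "continuous_on S (\<lambda>x. axis i (g x) :: 'c ^ 'n::finite)"
  unfolding axis_def
proof (rule continuous_on_vec_lambda)
  show "continuous_on S (\<lambda>x. if j = i then g x else 0)" for j
    using assms by (cases "j = i") auto
qed

text \<open>Young's inequality, from expanding the square of \<open>L u - v\<close>.\<close>

lemma inner_le_weighted_squares:
  assumes "0 < L"
  shows "inner u v \<le> L / 2 * (norm u)\<^sup>2 + 1 / (2 * L) * (norm v)\<^sup>2"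
proof -
  have "0 \<le> (norm (L *\<^sub>R u - v))\<^sup>2" by simp
  also have "\<dots> = L\<^sup>2 * (norm u)\<^sup>2 - 2 * L * inner u v + (norm v)\<^sup>2"
    unfolding power2_norm_eq_inner
    by (simp add: inner_diff_left inner_diff_right inner_commute power2_eq_square algebra_simps)
  finally have "2 * L * inner u v \<le> L\<^sup>2 * (norm u)\<^sup>2 + (norm v)\<^sup>2" by simp
  then show ?thesis
    using assms by (simp add: field_simps power2_eq_square)
qed

subsection \<open>The cost function of a sensor network\<close>

locale sensor_network =
  fixes E :: "('n::{finite,linorder} \<times> 'n) set"
    and A :: "'n \<Rightarrow> 'm::finite set"
    and a :: "'m \<Rightarrow> real ^ 'p::finite"
    and d :: "'n \<Rightarrow> 'n \<Rightarrow> real"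
    and r :: "'n \<Rightarrow> 'm \<Rightarrow> real"
  assumes simple_graph: "irrefl E" "sym E"
    and connected: "(i, j) \<in> E\<^sup>*"
    and anchored: "\<exists>i. A i \<noteq> {}"
    and d_nonneg: "(i, j) \<in> E \<Longrightarrow> d i j \<ge> 0"
    and r_nonneg: "k \<in> A i \<Longrightarrow> r i k \<ge> 0"
begin

abbreviation "f \<equiv> fhat E A a d r"

abbreviation "L \<equiv> L_fhat E A"

abbreviation "edges \<equiv> {(i, j) \<in> E. i < j}"

abbreviation edge_residual :: "real ^ 'p ^ 'n::{finite,linorder} \<Rightarrow> 'n \<Rightarrow> 'n \<Rightarrow> real ^ 'p" where
  "edge_residual x i j \<equiv> residual (cball 0 (d i j)) (x $ i - x $ j)"

abbreviation "anchor_residual x i k \<equiv> residual (cball (a k) (r i k)) (x $ i)"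

text \<open>The candidate for the gradient by the chain rule: an edge term depends on
  \<open>x $ i - x $ j\<close>, so its residual acts on the two endpoints with opposite signs.
  \<open>block_gradient_fhat\<close> confirms it.\<close>

definition grad :: "real ^ 'p ^ 'n::{finite,linorder} \<Rightarrow> real ^ 'p ^ 'n::{finite,linorder}" where
  "grad x = (\<Sum>(i, j)\<in>edges. axis i (edge_residual x i j) - axis j (edge_residual x i j)) +
     (\<Sum>i\<in>UNIV. \<Sum>k\<in>A i. axis i (anchor_residual x i k))"

lemma inner_grad:
  "inner (grad x) v = (\<Sum>(i, j)\<in>edges. inner (edge_residual x i j) (v $ i - v $ j)) +
     (\<Sum>i\<in>UNIV. \<Sum>k\<in>A i. inner (anchor_residual x i k) (v $ i))"
  by (simp add: grad_def inner_add_left inner_sum_left inner_diff_left inner_diff_right inner_axis'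
      case_prod_unfold)

text \<open>The quadratic form of the graph Laplacian plus the diagonal matrix of anchor
  counts.\<close>

definition stretch :: "real ^ 'p ^ 'n::{finite,linorder} \<Rightarrow> real" where
  "stretch v = (\<Sum>(i, j)\<in>edges. (norm (v $ i - v $ j))\<^sup>2) + (\<Sum>i\<in>UNIV. \<Sum>k\<in>A i. (norm (v $ i))\<^sup>2)"

lemma cball_edge:
  assumes "(i, j) \<in> edges"
  shows "convex (cball (0 :: real ^ 'p) (d i j))" "closed (cball (0 :: real ^ 'p) (d i j))"
    "cball (0 :: real ^ 'p) (d i j) \<noteq> {}"
  using assms d_nonneg[of i j] by auto

lemma cball_anchor:
  assumes "k \<in> A i"
  shows "convex (cball (a k) (r i k))" "closed (cball (a k) (r i k))" "cball (a k) (r i k) \<noteq> {}"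
  using r_nonneg[OF assms] by auto

section \<open>The constant \<open>L\<close>, quadratic bounds on the cost and co-coercivity of its
  gradient\<close>

lemma L_fhat_pos: "L > 0"
proof -
  obtain i where "A i \<noteq> {}" using anchored by blast
  then have "0 < card (A i)" by (simp add: card_gt_0_iff)
  also have "card (A i) \<le> Max (range (\<lambda>i. card (A i)))" by simp
  finally show ?thesis by (simp add: L_fhat_def)
qed

lemma stretch_le: "stretch v \<le> L * (norm v)\<^sup>2"
proof -
  let ?\<delta> = "Max (range (degree_of E))" and ?\<alpha> = "Max (range (\<lambda>i. card (A i)))"
  have "(\<Sum>(i, j)\<in>edges. (norm (v $ i - v $ j))\<^sup>2)
      \<le> (\<Sum>(i, j)\<in>edges. 2 * (norm (v $ i))\<^sup>2 + 2 * (norm (v $ j))\<^sup>2)"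
  proof (intro sum_mono, clarify)
    fix i j
    \<comment> \<open>By the parallelogram law this square is the gap between the two sides.\<close>
    have "0 \<le> (norm (v $ i + v $ j))\<^sup>2" by simp
    then show "(norm (v $ i - v $ j))\<^sup>2 \<le> 2 * (norm (v $ i))\<^sup>2 + 2 * (norm (v $ j))\<^sup>2"
      by (simp add: power2_norm_eq_inner inner_diff_left inner_diff_right inner_add_left
          inner_add_right inner_commute)
  qed
  also have "\<dots> = (\<Sum>(i, j)\<in>edges. 2 * (norm (v $ i))\<^sup>2) + (\<Sum>(i, j)\<in>edges. 2 * (norm (v $ j))\<^sup>2)"
    by (simp add: case_prod_unfold sum.distrib)
  \<comment> \<open>Second endpoints are first endpoints of the reversed pairs. With both
    orientations each ordered pair of \<open>E\<close> occurs once, and grouping by the first node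
    produces the degrees.\<close>
  also have "(\<Sum>(i, j)\<in>edges. 2 * (norm (v $ j))\<^sup>2) = (\<Sum>(i, j)\<in>{(i, j) \<in> E. j < i}. 2 * (norm (v $ i))\<^sup>2)"
    using simple_graph(2)
    by (intro sum.reindex_bij_witness[of _ "\<lambda>(i, j). (j, i)" "\<lambda>(i, j). (j, i)"]) (auto dest: symD)
  also have "(\<Sum>(i, j)\<in>edges. 2 * (norm (v $ i))\<^sup>2) + \<dots>
      = (\<Sum>(i, j)\<in>edges \<union> {(i, j) \<in> E. j < i}. 2 * (norm (v $ i))\<^sup>2)"
    by (rule sum.union_disjoint[symmetric]) auto
  also have "edges \<union> {(i, j) \<in> E. j < i} = Sigma UNIV (\<lambda>i. {j. (i, j) \<in> E})"
    using simple_graph(1) by (auto simp: irrefl_def) (metis linorder_neqE)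
  also have "(\<Sum>(i, j)\<in>Sigma UNIV (\<lambda>i. {j. (i, j) \<in> E}). 2 * (norm (v $ i))\<^sup>2)
      = (\<Sum>i\<in>UNIV. \<Sum>j\<in>{j. (i, j) \<in> E}. 2 * (norm (v $ i))\<^sup>2)"
    by (rule sum.Sigma[symmetric]) auto
  also have "\<dots> = (\<Sum>i\<in>UNIV. 2 * real (degree_of E i) * (norm (v $ i))\<^sup>2)"
    by (simp add: degree_of_def mult.assoc mult.left_commute)
  also have "\<dots> \<le> (\<Sum>i\<in>UNIV. 2 * real ?\<delta> * (norm (v $ i))\<^sup>2)"
    by (intro sum_mono mult_right_mono mult_left_mono) auto
  finally have 1: "(\<Sum>(i, j)\<in>edges. (norm (v $ i - v $ j))\<^sup>2) \<le> 2 * real ?\<delta> * (norm v)\<^sup>2"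
    by (simp add: norm_power2_vec sum_distrib_left)
  have "(\<Sum>i\<in>UNIV. \<Sum>k\<in>A i. (norm (v $ i))\<^sup>2) \<le> (\<Sum>i\<in>UNIV. real ?\<alpha> * (norm (v $ i))\<^sup>2)"
    unfolding sum_constant by (intro sum_mono mult_right_mono) auto
  also have "\<dots> = real ?\<alpha> * (norm v)\<^sup>2"
    by (simp add: norm_power2_vec sum_distrib_left)
  finally show ?thesis
    using 1 by (simp add: stretch_def L_fhat_def distrib_right)
qed

lemma fhat_lower: "f x + inner (grad x) (y - x) \<le> f y"
proof -
  have "f x + inner (grad x) (y - x)
      = (\<Sum>(i, j)\<in>edges. 1/2 * sqdist (cball 0 (d i j)) (x $ i - x $ j) +
           inner (edge_residual x i j) ((y - x) $ i - (y - x) $ j)) +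
        (\<Sum>i\<in>UNIV. \<Sum>k\<in>A i. 1/2 * sqdist (cball (a k) (r i k)) (x $ i) +
           inner (anchor_residual x i k) ((y - x) $ i))"
    unfolding inner_grad fhat_def by (simp add: sum.distrib case_prod_unfold)
  also have "\<dots> \<le> f y"
    unfolding fhat_def
  proof (intro add_mono sum_mono, clarify)
    fix i j assume "(i, j) \<in> E" "i < j"
    then have e: "(i, j) \<in> edges" by simp
    show "1/2 * sqdist (cball 0 (d i j)) (x $ i - x $ j) +
        inner (edge_residual x i j) ((y - x) $ i - (y - x) $ j)
      \<le> 1/2 * sqdist (cball 0 (d i j)) (y $ i - y $ j)"
      using half_sqdist_lower[OF cball_edge[OF e], of "x $ i - x $ j" "y $ i - y $ j"]
      by (simp add: algebra_simps)
  next
    fix i k assume "k \<in> A i"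
    then show "1/2 * sqdist (cball (a k) (r i k)) (x $ i) + inner (anchor_residual x i k) ((y - x) $ i)
      \<le> 1/2 * sqdist (cball (a k) (r i k)) (y $ i)"
      using half_sqdist_lower[OF cball_anchor, of k i "x $ i" "y $ i"] by simp
  qed
  finally show ?thesis .
qed

text \<open>The quadratic remainders of the single terms add up to half of
  \<open>stretch (y - x)\<close>, which \<open>stretch_le\<close> bounds.\<close>

lemma fhat_upper: "f y \<le> f x + inner (grad x) (y - x) + L / 2 * (norm (y - x))\<^sup>2"
proof -
  have "f y \<le> (\<Sum>(i, j)\<in>edges. 1/2 * sqdist (cball 0 (d i j)) (x $ i - x $ j) +
           inner (edge_residual x i j) ((y - x) $ i - (y - x) $ j) +
           1/2 * (norm ((y - x) $ i - (y - x) $ j))\<^sup>2) +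
        (\<Sum>i\<in>UNIV. \<Sum>k\<in>A i. 1/2 * sqdist (cball (a k) (r i k)) (x $ i) +
           inner (anchor_residual x i k) ((y - x) $ i) + 1/2 * (norm ((y - x) $ i))\<^sup>2)"
    unfolding fhat_def
  proof (intro add_mono sum_mono, clarify)
    fix i j assume "(i, j) \<in> E" "i < j"
    then have e: "(i, j) \<in> edges" by simp
    show "1/2 * sqdist (cball 0 (d i j)) (y $ i - y $ j)
      \<le> 1/2 * sqdist (cball 0 (d i j)) (x $ i - x $ j) +
        inner (edge_residual x i j) ((y - x) $ i - (y - x) $ j) +
        1/2 * (norm ((y - x) $ i - (y - x) $ j))\<^sup>2"
      using half_sqdist_upper[OF cball_edge[OF e], of "y $ i - y $ j" "x $ i - x $ j"]
      by (simp add: algebra_simps)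
  next
    fix i k assume "k \<in> A i"
    then show "1/2 * sqdist (cball (a k) (r i k)) (y $ i)
      \<le> 1/2 * sqdist (cball (a k) (r i k)) (x $ i) + inner (anchor_residual x i k) ((y - x) $ i) +
        1/2 * (norm ((y - x) $ i))\<^sup>2"
      using half_sqdist_upper[OF cball_anchor, of k i "y $ i" "x $ i"] by simp
  qed
  also have "\<dots> = f x + inner (grad x) (y - x) + 1/2 * stretch (y - x)"
    unfolding inner_grad fhat_def stretch_def
    by (simp add: sum.distrib case_prod_unfold sum_divide_distrib add_divide_distrib)
  also have "\<dots> \<le> f x + inner (grad x) (y - x) + L / 2 * (norm (y - x))\<^sup>2"
    using stretch_le[of "y - x"] by simp
  finally show ?thesis .
qed

text \<open>For points differing in one block, \<open>fhat_lower\<close> and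
  \<open>fhat_upper\<close> enclose the first-order remainder between 0 and a quadratic.\<close>

lemma block_gradient_fhat: "block_gradient f i x = grad x $ i"
proof (rule block_gradient_eqI, rule gderiv_quadratic_bound)
  fix z
  let ?y = "set_block x i z"
  have "?y - x = axis i (z - x $ i)" by (simp add: set_block_eq_axis)
  moreover have "set_block x i (x $ i) = x" by (simp add: set_block_def vec_eq_iff)
  ultimately show "\<bar>f ?y - f (set_block x i (x $ i)) - inner (grad x $ i) (z - x $ i)\<bar>
      \<le> L / 2 * (norm (z - x $ i))\<^sup>2"
    using fhat_lower[of x ?y] fhat_upper[of ?y x] by (simp add: inner_axis norm_axis)
qed

lemma gradient_step_fhat: "gradient_step L f i x = x - axis i ((1 / L) *\<^sub>R grad x $ i)"
  by (simp add: gradient_step_def set_block_eq_axis block_gradient_fhat vec_eq_iff axis_def)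

text \<open>The sum \<open>S\<close> of squared residual differences mediates: firm nonexpansiveness
  of each term bounds it by the inner product, while Young's inequality and
  \<open>stretch_le\<close> bound the squared norm by \<open>L * S\<close>.\<close>

lemma grad_cocoercive: "(norm (grad x - grad y))\<^sup>2 \<le> L * inner (grad x - grad y) (x - y)"
proof -
  let ?g = "grad x - grad y"
  define u where "u i j = edge_residual x i j - edge_residual y i j" for i j
  define w where "w i k = anchor_residual x i k - anchor_residual y i k" for i k
  define S where "S = (\<Sum>(i, j)\<in>edges. (norm (u i j))\<^sup>2) + (\<Sum>i\<in>UNIV. \<Sum>k\<in>A i. (norm (w i k))\<^sup>2)"
  have inner_g: "inner ?g v = (\<Sum>(i, j)\<in>edges. inner (u i j) (v $ i - v $ j)) +
     (\<Sum>i\<in>UNIV. \<Sum>k\<in>A i. inner (w i k) (v $ i))" for v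
    unfolding inner_diff_left[of "grad x"] inner_grad u_def w_def
    by (simp add: inner_diff_left sum_subtractf case_prod_unfold)
  have "S \<le> inner ?g (x - y)"
    unfolding S_def inner_g
  proof (intro add_mono sum_mono, clarify)
    fix i j assume "(i, j) \<in> E" "i < j"
    then have e: "(i, j) \<in> edges" by simp
    show "(norm (u i j))\<^sup>2 \<le> inner (u i j) ((x - y) $ i - (x - y) $ j)"
      using residual_firmly_nonexpansive[OF cball_edge[OF e], of "x $ i - x $ j" "y $ i - y $ j"]
      by (simp add: u_def algebra_simps)
  next
    fix i k assume "k \<in> A i"
    then show "(norm (w i k))\<^sup>2 \<le> inner (w i k) ((x - y) $ i)"
      using residual_firmly_nonexpansive[OF cball_anchor, of k i "x $ i" "y $ i"] by (simp add: w_def)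
  qed
  moreover have "(norm ?g)\<^sup>2 \<le> L * S"
  proof -
    (* Testing inner_g with ?g itself: applying Cauchy-Schwarz at each node instead would only give
       the constant 2 * (max degree + max number of anchors). *)
    have "(norm ?g)\<^sup>2 \<le> (\<Sum>(i, j)\<in>edges. L / 2 * (norm (u i j))\<^sup>2 + 1 / (2 * L) * (norm (?g $ i - ?g $ j))\<^sup>2) +
        (\<Sum>i\<in>UNIV. \<Sum>k\<in>A i. L / 2 * (norm (w i k))\<^sup>2 + 1 / (2 * L) * (norm (?g $ i))\<^sup>2)"
      unfolding power2_norm_eq_inner[of ?g] inner_g
      by (intro add_mono sum_mono, clarify) (intro inner_le_weighted_squares L_fhat_pos)+
    also have "\<dots> = L / 2 * S + 1 / (2 * L) * stretch ?g"
      unfolding S_def stretch_def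
      by (simp only: sum.distrib case_prod_unfold sum_distrib_left distrib_left add_ac)
    also have "\<dots> \<le> L / 2 * S + 1 / (2 * L) * (L * (norm ?g)\<^sup>2)"
      using L_fhat_pos by (intro add_left_mono mult_left_mono stretch_le) simp
    also have "\<dots> = L / 2 * S + 1 / 2 * (norm ?g)\<^sup>2"
      using L_fhat_pos by simp
    finally show ?thesis by simp
  qed
  ultimately show ?thesis
    using L_fhat_pos by (meson less_imp_le mult_left_mono order_trans)
qed

section \<open>Continuity of the gradient, the steps and the cost\<close>

lemma continuous_on_edge_residual:
  assumes "(i, j) \<in> edges"
  shows "continuous_on UNIV (\<lambda>x. edge_residual x i j)"
  by (rule continuous_on_compose2[OF continuous_on_residual[OF cball_edge[OF assms]]])
    (intro continuous_intros subset_UNIV)+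

lemma continuous_on_anchor_residual:
  assumes "k \<in> A i"
  shows "continuous_on UNIV (\<lambda>x. anchor_residual x i k)"
  by (rule continuous_on_compose2[OF continuous_on_residual[OF cball_anchor[OF assms]]])
    (intro continuous_intros subset_UNIV)+

lemma continuous_on_grad: "continuous_on UNIV grad"
  unfolding grad_def case_prod_unfold
  by (intro continuous_intros continuous_on_edge_residual continuous_on_anchor_residual) auto

lemma continuous_on_gradient_step: "continuous_on UNIV (gradient_step L f i)"
  unfolding gradient_step_fhat[abs_def]
  by (intro continuous_intros continuous_on_grad)

lemma continuous_on_fhat: "continuous_on UNIV f"
proof -
  have *: "f = (\<lambda>x. (\<Sum>(i, j)\<in>edges. 1/2 * (norm (edge_residual x i j))\<^sup>2) +
     (\<Sum>i\<in>UNIV. \<Sum>k\<in>A i. 1/2 * (norm (anchor_residual x i k))\<^sup>2))"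
    unfolding fhat_def
    by (intro ext arg_cong2[where f = "(+)"] sum.cong refl)
      (auto simp: sqdist_eq[OF cball_edge] sqdist_eq[OF cball_anchor])
  show ?thesis
    unfolding * case_prod_unfold
    by (intro continuous_intros continuous_on_edge_residual continuous_on_anchor_residual) auto
qed

section \<open>Coercivity and existence of a minimizer\<close>

lemma sqdist_edge_nonneg: "(i, j) \<in> edges \<Longrightarrow> 0 \<le> sqdist (cball (0 :: real ^ 'p) (d i j)) v"
  by (simp only: sqdist_eq[OF cball_edge] zero_le_power2)

lemma sqdist_anchor_nonneg: "k \<in> A i \<Longrightarrow> 0 \<le> sqdist (cball (a k) (r i k)) v"
  by (simp only: sqdist_eq[OF cball_anchor] zero_le_power2)

lemma sqdist_edge_le:
  assumes "(i, j) \<in> edges"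
  shows "sqdist (cball 0 (d i j)) (x $ i - x $ j) \<le> 2 * f x"
proof -
  have "1/2 * sqdist (cball 0 (d i j)) (x $ i - x $ j)
      \<le> (\<Sum>(i, j)\<in>edges. 1/2 * sqdist (cball 0 (d i j)) (x $ i - x $ j))"
    using member_le_sum[OF assms, of "\<lambda>(i, j). 1/2 * sqdist (cball 0 (d i j)) (x $ i - x $ j)"]
      sqdist_edge_nonneg by auto
  moreover have "0 \<le> (\<Sum>i\<in>UNIV. \<Sum>k\<in>A i. 1/2 * sqdist (cball (a k) (r i k)) (x $ i))"
    using sqdist_anchor_nonneg by (intro sum_nonneg) simp
  ultimately show ?thesis by (simp add: fhat_def)
qed

lemma sqdist_anchor_le:
  assumes "k \<in> A i"
  shows "sqdist (cball (a k) (r i k)) (x $ i) \<le> 2 * f x"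
proof -
  have "1/2 * sqdist (cball (a k) (r i k)) (x $ i) \<le> (\<Sum>k\<in>A i. 1/2 * sqdist (cball (a k) (r i k)) (x $ i))"
    using member_le_sum[OF assms, of "\<lambda>k. 1/2 * sqdist (cball (a k) (r i k)) (x $ i)"]
      sqdist_anchor_nonneg by auto
  also have "\<dots> \<le> (\<Sum>i\<in>UNIV. \<Sum>k\<in>A i. 1/2 * sqdist (cball (a k) (r i k)) (x $ i))"
    using sqdist_anchor_nonneg
    by (intro member_le_sum[of i UNIV "\<lambda>i. \<Sum>k\<in>A i. 1/2 * sqdist (cball (a k) (r i k)) (x $ i)"] sum_nonneg) auto
  moreover have "0 \<le> (\<Sum>(i, j)\<in>edges. 1/2 * sqdist (cball 0 (d i j)) (x $ i - x $ j))"
    using sqdist_edge_nonneg by (intro sum_nonneg) auto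
  ultimately show ?thesis by (simp add: fhat_def)
qed

lemma fhat_nonneg: "0 \<le> f x"
  using sqdist_anchor_le sqdist_anchor_nonneg anchored by (smt (verit) equals0I)

lemma minimizers_fhat: "x \<in> minimizers f \<longleftrightarrow> (\<forall>y. f x \<le> f y)"
  by (rule mem_minimizers_iff) (auto intro!: bdd_belowI[of _ 0] fhat_nonneg)

text \<open>A full gradient step of length \<open>1 / L\<close> lowers \<open>f\<close> by at least
  the squared gradient norm over \<open>2 * L\<close>, which a minimizer rules out; the converse is
  convexity.\<close>

lemma minimizer_iff_grad_eq_0: "x \<in> minimizers f \<longleftrightarrow> grad x = 0"
proof
  assume "x \<in> minimizers f"
  then have "f x \<le> f (x - (1 / L) *\<^sub>R grad x)"
    by (simp add: minimizers_fhat)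
  also have "\<dots> \<le> f x - 1 / (2 * L) * (norm (grad x))\<^sup>2"
    using fhat_upper[of "x - (1 / L) *\<^sub>R grad x" x] L_fhat_pos
    by (simp add: power2_norm_eq_inner[symmetric] field_simps power2_eq_square)
  finally show "grad x = 0"
    using L_fhat_pos by (simp add: field_simps)
next
  assume "grad x = 0"
  then show "x \<in> minimizers f"
    using fhat_lower[of x] by (simp add: minimizers_fhat)
qed

text \<open>The cost contains each edge with the smaller label first; the maximum covers both
  orientations.\<close>

lemma edge_length_bound:
  assumes "(i, j) \<in> E" "f x \<le> c"
  shows "norm (x $ i - x $ j) \<le> max (d i j) (d j i) + sqrt (2 * c)"
proof -
  have *: "norm (x $ i - x $ j) \<le> d i j + sqrt (2 * c)" if "(i, j) \<in> edges" for i j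
  proof -
    have "norm (x $ i - x $ j) \<le> d i j + sqrt (sqdist (cball 0 (d i j)) (x $ i - x $ j))"
      using norm_le_sqrt_sqdist[of "d i j" "x $ i - x $ j" 0] that d_nonneg by simp
    also have "\<dots> \<le> d i j + sqrt (2 * c)"
      using sqdist_edge_le[OF that, of x] assms(2) by simp
    finally show ?thesis .
  qed
  have "i \<noteq> j" using assms(1) simple_graph(1) by (auto simp: irrefl_def)
  then consider "(i, j) \<in> edges" | "(j, i) \<in> edges"
    using assms(1) symD[OF simple_graph(2) assms(1)] by (cases "i < j") auto
  then show ?thesis
    using *[of i j] *[of j i] by cases (auto simp: norm_minus_commute)
qed

text \<open>The anchor confines one sensor, and every edge on a path from it adds a bounded amount;
  connectedness reaches all sensors.\<close>

lemma bounded_sublevel: "bounded {x. f x \<le> c}"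
proof -
  obtain i0 k where k: "k \<in> A i0" using anchored by blast
  have "\<exists>B. \<forall>x. f x \<le> c \<longrightarrow> norm (x $ j) \<le> B" for j
    using connected[of i0 j]
  proof (induction rule: rtrancl_induct)
    case base
    have "norm (x $ i0) \<le> norm (a k) + r i0 k + sqrt (2 * c)" if "f x \<le> c" for x
    proof -
      have "norm (x $ i0 - a k) \<le> r i0 k + sqrt (sqdist (cball (a k) (r i0 k)) (x $ i0))"
        by (rule norm_le_sqrt_sqdist) (rule r_nonneg[OF k])
      also have "\<dots> \<le> r i0 k + sqrt (2 * c)"
        using sqdist_anchor_le[OF k, of x] that by simp
      finally show ?thesis
        using norm_triangle_ineq2[of "x $ i0" "a k"] by simp
    qed
    then show ?case by blast
  next
    case (step i j)
    then obtain B where B: "\<And>x. f x \<le> c \<Longrightarrow> norm (x $ i) \<le> B" by blast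
    have "norm (x $ j) \<le> B + (max (d i j) (d j i) + sqrt (2 * c))" if "f x \<le> c" for x
      using B[OF that] edge_length_bound[OF step(2) that] norm_triangle_ineq3[of "x $ i" "x $ j"]
      by simp
    then show ?case by blast
  qed
  then obtain B where B: "\<And>j x. f x \<le> c \<Longrightarrow> norm (x $ j) \<le> B j" by metis
  have "norm x \<le> (\<Sum>j\<in>UNIV. B j)" if "f x \<le> c" for x
  proof -
    have "norm x \<le> (\<Sum>j\<in>UNIV. norm (x $ j))"
      unfolding norm_vec_def by (rule L2_set_le_sum) simp
    also have "\<dots> \<le> (\<Sum>j\<in>UNIV. B j)"
      by (intro sum_mono B that)
    finally show ?thesis .
  qed
  then show ?thesis
    by (intro boundedI) auto
qed

lemma minimizer_exists: "\<exists>x. grad x = 0"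
proof -
  let ?K = "{x. f x \<le> f 0}"
  have "closed ?K"
    by (intro closed_Collect_le continuous_on_fhat continuous_on_const)
  then have "compact ?K"
    using bounded_sublevel by (simp add: compact_eq_bounded_closed)
  moreover have "?K \<noteq> {}" by blast
  moreover have "continuous_on ?K f"
    using continuous_on_fhat by (rule continuous_on_subset) simp
  ultimately have "\<exists>x\<in>?K. \<forall>y\<in>?K. f x \<le> f y"
    by (rule continuous_attains_inf)
  then obtain x where x: "f x \<le> f 0" "\<And>y. f y \<le> f 0 \<Longrightarrow> f x \<le> f y"
    by blast
  have "f x \<le> f y" for y
  proof (cases "f y \<le> f 0")
    case False
    then show ?thesis using x(1) by linarith
  qed (rule x(2))
  then show ?thesis
    using minimizer_iff_grad_eq_0 minimizers_fhat by blast
qed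

text \<open>Summing over blocks reassembles the full gradient in the cross terms and in the squares.
  By co-coercivity, half of the cross term absorbs the squares and the other half yields the
  decrease.\<close>

lemma sum_dist_gradient_step_le:
  assumes "grad y = 0"
  shows "(\<Sum>i\<in>UNIV. (dist (gradient_step L f i x) y)\<^sup>2)
    \<le> real CARD('n) * (dist x y)\<^sup>2 - (norm (grad x))\<^sup>2 / L\<^sup>2"
proof -
  have "(dist (gradient_step L f i x) y)\<^sup>2
      = (dist x y)\<^sup>2 - 2 / L * inner (grad x $ i) ((x - y) $ i) + 1 / L\<^sup>2 * (norm (grad x $ i))\<^sup>2" for i
  proof -
    have eq: "gradient_step L f i x - y = (x - y) - axis i ((1 / L) *\<^sub>R grad x $ i)"
      by (simp add: gradient_step_fhat)
    show ?thesis
      unfolding dist_norm eq power2_norm_eq_inner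
      by (simp add: inner_diff_left inner_diff_right inner_axis inner_axis' inner_axis_axis
          inner_commute power2_eq_square algebra_simps)
  qed
  then have "(\<Sum>i\<in>UNIV. (dist (gradient_step L f i x) y)\<^sup>2)
      = real CARD('n) * (dist x y)\<^sup>2 - 2 / L * inner (grad x) (x - y) + 1 / L\<^sup>2 * (norm (grad x))\<^sup>2"
    by (simp add: sum.distrib sum_subtractf norm_power2_vec inner_vec_def[of "grad x"] sum_distrib_left)
  moreover have "1 / L\<^sup>2 * (norm (grad x))\<^sup>2 \<le> 1 / L\<^sup>2 * (L * inner (grad x) (x - y))"
    using grad_cocoercive[of x y] assms by (intro mult_left_mono) auto
  moreover have "1 / L\<^sup>2 * (L * inner (grad x) (x - y)) = 1 / L * inner (grad x) (x - y)"
    using L_fhat_pos by (simp add: power2_eq_square)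
  ultimately show ?thesis by simp
qed

end

subsection \<open>Almost sure convergence\<close>

theorem theorem3:
  fixes E :: "('n::{finite,linorder} \<times> 'n) set"
    and A :: "'n \<Rightarrow> 'm::finite set"
    and a :: "'m \<Rightarrow> real ^ 'p::finite"
    and d :: "'n \<Rightarrow> 'n \<Rightarrow> real"
    and r :: "'n \<Rightarrow> 'm \<Rightarrow> real"
    and M :: "'w measure"
    and \<xi> :: "nat \<Rightarrow> 'w \<Rightarrow> 'n"
    and x :: "nat \<Rightarrow> 'w \<Rightarrow> real ^ 'p ^ 'n::{finite,linorder}"
  assumes dim: "CARD('p) \<in> {2, 3}"
    and simple_graph: "irrefl E" "sym E"
    and connected: "\<And>i j. (i, j) \<in> E\<^sup>*"
    and anchored: "\<exists>i. A i \<noteq> {}"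
    and d_nonneg: "\<And>i j. (i, j) \<in> E \<Longrightarrow> d i j \<ge> 0"
    and d_sym: "\<And>i j. (i, j) \<in> E \<Longrightarrow> d i j = d j i"
    and r_nonneg: "\<And>i k. k \<in> A i \<Longrightarrow> r i k \<ge> 0"
    and prob: "prob_space M"
    and xi_indep: "prob_space.indep_vars M (\<lambda>_. count_space UNIV) \<xi> {1..}"
    and xi_uniform:
      "\<And>k i. k \<ge> 1 \<Longrightarrow> measure M {\<omega> \<in> space M. \<xi> k \<omega> = i} = 1 / real CARD('n)"
    and x0_indep: "indep_rvs M borel (x 0)
      (\<Pi>\<^sub>M k\<in>{1..}. count_space UNIV) (\<lambda>\<omega>. \<lambda>k\<in>{1..}. \<xi> k \<omega>)"
    and iteration: "\<And>k \<omega>. k \<ge> 1 \<Longrightarrow> \<omega> \<in> space M \<Longrightarrow>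
      x k \<omega> = gradient_step (L_fhat E A) (fhat E A a d r) (\<xi> k \<omega>) (x (k - 1) \<omega>)"
  shows "AE \<omega> in M. \<exists>xstar \<in> minimizers (fhat E A a d r). (\<lambda>k. x k \<omega>) \<longlonglongrightarrow> xstar"
proof -
  interpret prob_space M by fact
  interpret N: sensor_network E A a d r
    using simple_graph connected anchored d_nonneg r_nonneg by unfold_locales
  define p where "p = pmf_of_set (UNIV :: 'n set)"
  \<comment> \<open>The expected decrease per step: \<open>L\<^sup>2\<close> comes from the step
    length, \<open>CARD('n)\<close> from averaging over the uniform activation.\<close>
  define \<phi> where "\<phi> z = (norm (N.grad z))\<^sup>2 / (real CARD('n) * N.L\<^sup>2)" for z
  let ?T = "gradient_step N.L N.f"
  let ?\<Omega> = "stream_space (measure_pmf p)"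
  have \<phi>_eq_0: "\<phi> z = 0 \<longleftrightarrow> N.grad z = 0" for z
    using N.L_fhat_pos by (simp add: \<phi>_def)
  interpret F: stochastic_fejer p ?T \<phi>
  proof
    show "?T i \<in> borel_measurable borel" for i
      by (intro borel_measurable_continuous_onI N.continuous_on_gradient_step)
    show "continuous_on UNIV \<phi>"
      unfolding \<phi>_def using N.L_fhat_pos by (intro continuous_intros N.continuous_on_grad) auto
    show "\<phi> z \<ge> 0" for z by (simp add: \<phi>_def)
    show "\<exists>y. \<phi> y = 0" using N.minimizer_exists by (simp add: \<phi>_eq_0)
    fix y z assume "\<phi> y = 0"
    then have "(\<Sum>i\<in>UNIV. (dist (?T i z) y)\<^sup>2) \<le> real CARD('n) * ((dist z y)\<^sup>2 - \<phi> z)"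
      using N.sum_dist_gradient_step_le[of y z] by (simp add: \<phi>_eq_0) (simp add: \<phi>_def right_diff_distrib)
    then have "(\<Sum>i\<in>UNIV. (dist (?T i z) y)\<^sup>2) / real CARD('n) + \<phi> z \<le> (dist z y)\<^sup>2"
      by (simp add: field_simps)
    moreover have "(\<integral>\<^sup>+i. ennreal ((dist (?T i z) y)\<^sup>2) \<partial>measure_pmf p)
        = ennreal ((\<Sum>i\<in>UNIV. (dist (?T i z) y)\<^sup>2) / real CARD('n))"
      unfolding p_def
      by (subst nn_integral_pmf_of_set)
        (simp_all add: sum_ennreal ennreal_of_nat_eq_real_of_nat divide_ennreal sum_nonneg)
    ultimately show "(\<integral>\<^sup>+i. ennreal ((dist (?T i z) y)\<^sup>2) \<partial>measure_pmf p) + ennreal (\<phi> z)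
        \<le> ennreal ((dist z y)\<^sup>2)"
      by (simp add: ennreal_plus[symmetric] \<phi>_def sum_nonneg del: ennreal_plus)
  qed
  have xi_rv: "\<xi> k \<in> measurable M (count_space UNIV)" if "k \<ge> 1" for k
    using xi_indep that by (auto simp: indep_vars_def)
  have law: "distr M (count_space UNIV) (\<xi> k) = measure_pmf p" if k: "k \<ge> 1" for k
  proof (rule measure_eqI_countable[where A = UNIV])
    fix i :: 'n
    have "emeasure (distr M (count_space UNIV) (\<xi> k)) {i} = emeasure M {\<omega> \<in> space M. \<xi> k \<omega> = i}"
      using xi_rv[OF k] by (subst emeasure_distr) (auto intro!: arg_cong[where f = "emeasure M"])
    also have "\<dots> = emeasure (measure_pmf p) {i}"
      using xi_uniform[OF k] by (simp add: emeasure_eq_measure emeasure_pmf_single p_def)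
    finally show "emeasure (distr M (count_space UNIV) (\<xi> k)) {i} = emeasure (measure_pmf p) {i}" .
  qed auto
  define \<sigma> where "\<sigma> \<omega> = to_stream (\<lambda>k. \<xi> (Suc k) \<omega>)" for \<omega>
  have indep: "indep_rvs M borel (x 0) ?\<Omega> \<sigma>"
    using indep_rvs_compose[OF x0_indep measurable_to_stream_Suc, of p] by (simp add: \<sigma>_def[abs_def])
  then have x0: "x 0 \<in> borel_measurable M" and \<sigma>: "\<sigma> \<in> measurable M ?\<Omega>"
    by (simp_all add: indep_rvs_def)
  \<comment> \<open>Independence of start and activations makes the joint law a product, the setting
    of the Fubini version of convergence.\<close>
  have joint: "distr M (borel \<Otimes>\<^sub>M ?\<Omega>) (\<lambda>\<omega>. (x 0 \<omega>, \<sigma> \<omega>)) = distr M borel (x 0) \<Otimes>\<^sub>M ?\<Omega>"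
    using indep_rvs_distr_pair[OF indep] distr_to_stream_Suc[OF xi_indep law] by (simp add: \<sigma>_def[abs_def])
  have "AE w in distr M (borel \<Otimes>\<^sub>M ?\<Omega>) (\<lambda>\<omega>. (x 0 \<omega>, \<sigma> \<omega>)).
      case w of (z, s) \<Rightarrow> \<exists>y. \<phi> y = 0 \<and> orbit ?T s z \<longlonglongrightarrow> y"
    unfolding joint by (rule F.AE_orbit_converges_pair[OF prob_space_distr[OF x0]]) simp
  then have "AE \<omega> in M. case (x 0 \<omega>, \<sigma> \<omega>) of (z, s) \<Rightarrow> \<exists>y. \<phi> y = 0 \<and> orbit ?T s z \<longlonglongrightarrow> y"
    by (rule AE_distrD[rotated]) (intro measurable_Pair x0 \<sigma>)
  then show ?thesis
  proof (rule AE_mp, intro AE_I2 impI)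
    fix \<omega> assume \<omega>: "\<omega> \<in> space M"
      and "case (x 0 \<omega>, \<sigma> \<omega>) of (z, s) \<Rightarrow> \<exists>y. \<phi> y = 0 \<and> orbit ?T s z \<longlonglongrightarrow> y"
    then obtain y where y: "N.grad y = 0" "orbit ?T (\<sigma> \<omega>) (x 0 \<omega>) \<longlonglongrightarrow> y"
      by (auto simp: \<phi>_eq_0)
    \<comment> \<open>On each sample point the algorithm is the deterministic orbit: letter
      \<open>k\<close> of \<open>\<sigma> \<omega>\<close> is activation
      \<open>k + 1\<close>.\<close>
    have "orbit ?T (\<sigma> \<omega>) (x 0 \<omega>) k = x k \<omega>" for k
    proof (induction k)
      case (Suc k)
      then show ?case
        using iteration[of "Suc k" \<omega>] \<omega> by (simp add: \<sigma>_def to_stream_def)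
    qed simp
    then have "orbit ?T (\<sigma> \<omega>) (x 0 \<omega>) = (\<lambda>k. x k \<omega>)"
      by (rule ext)
    then have "(\<lambda>k. x k \<omega>) \<longlonglongrightarrow> y"
      using y(2) by simp
    then show "\<exists>xstar\<in>minimizers N.f. (\<lambda>k. x k \<omega>) \<longlonglongrightarrow> xstar"
      using y(1) N.minimizer_iff_grad_eq_0 by blast
  qed
qed

end
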